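(* Let $\mathcal R$ be a finite, completely defined constructor term rewrite system over a (possibly variadic) signature $\mathcal F$ containing at least one constant, with defined symbols $\mathcal D$ and constructor symbols $\mathcal C$. Let $>$ be a precedence on $\mathcal F$ such that $f>c$ for all $f\in\mathcal D$ and $c\in\mathcal C$, and let $\mathrm{safe}$ be a safe mapping. If $\mathcal R\subseteq{>_{\mathrm{pop}*}}$ (the polynomial path order induced by $>$ and $\mathrm{safe}$), then the normal runtime complexity function $\mathrm{rc}^{\mathrm n}_{\mathcal R}$ and the innermost runtime complexity function of $\mathcal R$ are bounded by polynomials.
   Context: A constructor TRS: every left-hand side has the form $f(s_1,\dots,s_n)$ with $f\in\mathcal D$ and $s_i\in\mathcal T(\mathcal C,\mathcal V)$ (values). $\mathcal R$ is completely defined if no defined symbol occurs in a ground normal form. A precedence is a strict partial order on $\mathcal F$. A safe mapping assigns to each fixed-arity $f\in\mathcal D$ of arity $n$ a set $\mathrm{safe}(f)\subseteq\{1,\dots,n\}$; for constructors $\mathrm{safe}(f)$ is the set of all argument positions, and for variadic $f\in\mathcal D$, $\mathrm{safe}(f)=\emptyset$; the remaining positions form $\mathrm{normal}(f)$. $\rhd$ is the proper superterm relation. Define $\sqsupset$: $s=f(s_1,\dots,s_n)\sqsupset t$ iff (1) $f\in\mathcal C$ and $s_i\sqsupseteq t$ for some $i$; or (2) $s_i\sqsupseteq t$ for some $i\in\mathrm{normal}(f)$; or (3) $t=g(t_1,\dots,t_m)$, $f\in\mathcal D$, $f>g$ and $s\sqsupset t_i$ for all $i$ (here $\sqsupseteq$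 is $\sqsupset$ or equality). Define $>_{\mathrm{pop}*}$: $s=f(s_1,\dots,s_n)>_{\mathrm{pop}*}t$ iff (1) $s\sqsupset t$; or (2) $s_i\ge_{\mathrm{pop}*}t$ for some $i$; or (3) $t=g(t_1,\dots,t_m)$, $f\in\mathcal D$, $f>g$, and there is $i_0\in\mathrm{safe}(g)$ with $s>_{\mathrm{pop}*}t_{i_0}$ and for every $i\ne i_0$ either $s\sqsupset t_i$, or $s\rhd t_i$ and $i\in\mathrm{safe}(g)$; or (4) $t=f(t_1,\dots,t_m)$, the multiset of arguments of $s$ at normal positions is greater than the multiset of arguments of $t$ at normal positions in the multiset extension of $>_{\mathrm{pop}*}$, and the multiset of arguments of $s$ at safe positions is greater than or equal to that of $t$ in the multiset extension of $\ge_{\mathrm{pop}*}$. Basic terms $\mathcal T_b$: $f(t_1,\dots,t_n)$ with $f\in\mathcal D$ and all $t_i$ values. $\to^{\mathrm i}$ is innermost rewriting; $\mathrm{dh}(t,\to)$ is the maximal length of a $\to$-derivation from $t$. The innermost runtime complexity is $m\mapsto\max\{\mathrm{dh}(t,\to^{\mathrm i}_{\mathcal R})\mid t\in\mathcal T_b, |t|\le m\}$ and the normal runtime complexity is $\mathrm{rc}^{\mathrm n}_{\mathcal R}(m)=\max\{\mathrm{dh}(t,\to^{\mathrm i}_{\mathcal R})\mid t=f(t_1,\dots,t_n)\in\mathcal T_b,\ \sum_{i\in\mathrm{normal}(f)}|t_i|\le m\}$, where $|t|$ is the number of symbols of $t$. *)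

theory Defs
  imports
    "HOL-Library.Extended_Nat"
    "HOL-Library.Multiset_Order"
    "HOL-Computational_Algebra.Polynomial"
begin

datatype (funs: 'f, vars: 'v) trm = Var 'v | Fun 'f "('f, 'v) trm list"

fun tsize :: "('f, 'v) trm \<Rightarrow> nat" where
  "tsize (Var x) = 1"
| "tsize (Fun f ts) = Suc (\<Sum>t\<leftarrow>ts. tsize t)"

fun subst :: "('v \<Rightarrow> ('f, 'w) trm) \<Rightarrow> ('f, 'v) trm \<Rightarrow> ('f, 'w) trm" where
  "subst \<sigma> (Var x) = \<sigma> x"
| "subst \<sigma> (Fun f ts) = Fun f (map (subst \<sigma>) ts)"

inductive supt :: "('f, 'v) trm \<Rightarrow> ('f, 'v) trm \<Rightarrow> bool" (infix \<open>\<rhd>\<close> 50) where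
  arg: "t \<in> set ts \<Longrightarrow> Fun f ts \<rhd> t"
| deep: "s \<in> set ts \<Longrightarrow> s \<rhd> t \<Longrightarrow> Fun f ts \<rhd> t"

(* An arity function yields None for variadic symbols, which take any number of arguments.
   Argument positions are counted from 0. *)
inductive_set terms :: "'f set \<Rightarrow> ('f \<Rightarrow> nat option) \<Rightarrow> ('f, 'v) trm set"
  for F :: "'f set" and ar :: "'f \<Rightarrow> nat option" where
  "Var x \<in> terms F ar"
| "f \<in> F \<Longrightarrow> ar f = None \<or> ar f = Some (length ts) \<Longrightarrow> \<forall>t\<in>set ts. t \<in> terms F ar
    \<Longrightarrow> Fun f ts \<in> terms F ar"

definition precedence :: "'f set \<Rightarrow> ('f \<Rightarrow> 'f \<Rightarrow> bool) \<Rightarrow> bool" where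
  "precedence F gt \<longleftrightarrow> irreflp_on F gt \<and> transp_on F gt"

definition safe_mapping ::
  "'f set \<Rightarrow> 'f set \<Rightarrow> ('f \<Rightarrow> nat option) \<Rightarrow> ('f \<Rightarrow> nat set) \<Rightarrow> bool" where
  "safe_mapping D C ar safe \<longleftrightarrow>
    (\<forall>f\<in>D. case ar f of Some n \<Rightarrow> safe f \<subseteq> {..<n} | None \<Rightarrow> safe f = {}) \<and>
    (\<forall>f\<in>C. case ar f of Some n \<Rightarrow> safe f = {..<n} | None \<Rightarrow> safe f = UNIV)"

definition safe_args :: "('f \<Rightarrow> nat set) \<Rightarrow> 'f \<Rightarrow> ('f, 'v) trm list \<Rightarrow> ('f, 'v) trm list" where
  "safe_args safe f ts = nths ts (safe f)"

definition normal_args :: "('f \<Rightarrow> nat set) \<Rightarrow> 'f \<Rightarrow> ('f, 'v) trm list \<Rightarrow> ('f, 'v) trm list" where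
  "normal_args safe f ts = nths ts (- safe f)"

(* The relation written as a square superset sign in the literature on POP*. *)
inductive sqgt ::
  "'f set \<Rightarrow> 'f set \<Rightarrow> ('f \<Rightarrow> 'f \<Rightarrow> bool) \<Rightarrow> ('f \<Rightarrow> nat set) \<Rightarrow> ('f, 'v) trm \<Rightarrow> ('f, 'v) trm \<Rightarrow> bool"
  for D C :: "'f set" and gt :: "'f \<Rightarrow> 'f \<Rightarrow> bool" and safe :: "'f \<Rightarrow> nat set" where
  constr: "f \<in> C \<Longrightarrow> s \<in> set ss \<Longrightarrow> s = t \<or> sqgt D C gt safe s t
    \<Longrightarrow> sqgt D C gt safe (Fun f ss) t"
| normal: "s \<in> set (normal_args safe f ss) \<Longrightarrow> s = t \<or> sqgt D C gt safe s t
    \<Longrightarrow> sqgt D C gt safe (Fun f ss) t"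
| prec: "f \<in> D \<Longrightarrow> gt f g \<Longrightarrow> \<forall>t\<in>set ts. sqgt D C gt safe (Fun f ss) t
    \<Longrightarrow> sqgt D C gt safe (Fun f ss) (Fun g ts)"

(* multp\<^sub>D\<^sub>M r M N reads "M is below N", so an order "greater than" is passed with its
   arguments flipped. *)
definition mul_gt :: "('a \<Rightarrow> 'a \<Rightarrow> bool) \<Rightarrow> 'a multiset \<Rightarrow> 'a multiset \<Rightarrow> bool" where
  "mul_gt gr M N \<longleftrightarrow> multp\<^sub>D\<^sub>M (\<lambda>x y. gr y x) N M"

definition mul_ge :: "('a \<Rightarrow> 'a \<Rightarrow> bool) \<Rightarrow> 'a multiset \<Rightarrow> 'a multiset \<Rightarrow> bool" where
  "mul_ge gr M N \<longleftrightarrow> M = N \<or> mul_gt gr M N"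

lemma mul_gt_mono [mono]:
  assumes "\<And>x y. P x y \<longrightarrow> Q x y"
  shows "mul_gt P M N \<longrightarrow> mul_gt Q M N"
proof
  assume "mul_gt P M N"
  then obtain X Y where "X \<noteq> {#}" "X \<subseteq># M" "N = (M - X) + Y"
    and *: "\<forall>k. k \<in># Y \<longrightarrow> (\<exists>a. a \<in># X \<and> P a k)"
    unfolding mul_gt_def multp\<^sub>D\<^sub>M_def by (elim exE conjE)
  moreover from * assms have "\<forall>k. k \<in># Y \<longrightarrow> (\<exists>a. a \<in># X \<and> Q a k)" by blast
  ultimately show "mul_gt Q M N"
    unfolding mul_gt_def multp\<^sub>D\<^sub>M_def by (intro exI conjI)
qed

lemma mul_ge_mono [mono]:
  assumes "\<And>x y. P x y \<longrightarrow> Q x y"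
  shows "mul_ge P M N \<longrightarrow> mul_ge Q M N"
  proof -
  have "mul_gt P M N \<longrightarrow> mul_gt Q M N"
    by (rule mul_gt_mono) (rule assms)
  then show ?thesis unfolding mul_ge_def by blast
qed

inductive pop ::
  "'f set \<Rightarrow> 'f set \<Rightarrow> ('f \<Rightarrow> 'f \<Rightarrow> bool) \<Rightarrow> ('f \<Rightarrow> nat set) \<Rightarrow> ('f, 'v) trm \<Rightarrow> ('f, 'v) trm \<Rightarrow> bool"
  for D C :: "'f set" and gt :: "'f \<Rightarrow> 'f \<Rightarrow> bool" and safe :: "'f \<Rightarrow> nat set" where
  sq: "sqgt D C gt safe (Fun f ss) t \<Longrightarrow> pop D C gt safe (Fun f ss) t"
| sub: "s \<in> set ss \<Longrightarrow> s = t \<or> pop D C gt safe s t \<Longrightarrow> pop D C gt safe (Fun f ss) t"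
| prec: "f \<in> D \<Longrightarrow> gt f g \<Longrightarrow> i\<^sub>0 < length ts \<Longrightarrow> i\<^sub>0 \<in> safe g
    \<Longrightarrow> pop D C gt safe (Fun f ss) (ts ! i\<^sub>0)
    \<Longrightarrow> \<forall>i<length ts. i \<noteq> i\<^sub>0 \<longrightarrow>
          sqgt D C gt safe (Fun f ss) (ts ! i) \<or> (Fun f ss \<rhd> ts ! i \<and> i \<in> safe g)
    \<Longrightarrow> pop D C gt safe (Fun f ss) (Fun g ts)"
| mul: "mul_gt (pop D C gt safe) (mset (normal_args safe f ss)) (mset (normal_args safe f ts))
    \<Longrightarrow> mul_ge (pop D C gt safe) (mset (safe_args safe f ss)) (mset (safe_args safe f ts))
    \<Longrightarrow> pop D C gt safe (Fun f ss) (Fun f ts)"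

type_synonym ('f, 'v) trs = "(('f, 'v) trm \<times> ('f, 'v) trm) set"

definition is_trs :: "'f set \<Rightarrow> ('f \<Rightarrow> nat option) \<Rightarrow> ('f, 'v) trs \<Rightarrow> bool" where
  "is_trs F ar R \<longleftrightarrow> (\<forall>(l, r)\<in>R. l \<in> terms F ar \<and> r \<in> terms F ar \<and>
    (\<forall>x. l \<noteq> Var x) \<and> vars r \<subseteq> vars l)"

definition constructor_trs :: "'f set \<Rightarrow> 'f set \<Rightarrow> ('f \<Rightarrow> nat option) \<Rightarrow> ('f, 'v) trs \<Rightarrow> bool" where
  "constructor_trs D C ar R \<longleftrightarrow> is_trs (D \<union> C) ar R \<and>
    (\<forall>(l, r)\<in>R. \<exists>f ss. l = Fun f ss \<and> f \<in> D \<and> set ss \<subseteq> terms C ar)"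

inductive rstep :: "('f, 'v) trs \<Rightarrow> ('f, 'v) trm \<Rightarrow> ('f, 'v) trm \<Rightarrow> bool"
  for R :: "('f, 'v) trs" where
  root: "(l, r) \<in> R \<Longrightarrow> rstep R (subst \<sigma> l) (subst \<sigma> r)"
| ctxt: "rstep R s t \<Longrightarrow> rstep R (Fun f (us @ s # vs)) (Fun f (us @ t # vs))"

definition normal_form :: "('f, 'v) trs \<Rightarrow> ('f, 'v) trm \<Rightarrow> bool" where
  "normal_form R t \<longleftrightarrow> (\<nexists>u. rstep R t u)"

inductive irstep :: "('f, 'v) trs \<Rightarrow> ('f, 'v) trm \<Rightarrow> ('f, 'v) trm \<Rightarrow> bool"
  for R :: "('f, 'v) trs" where
  root: "(l, r) \<in> R \<Longrightarrow> \<forall>u. subst \<sigma> l \<rhd> u \<longrightarrow> normal_form R u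
    \<Longrightarrow> irstep R (subst \<sigma> l) (subst \<sigma> r)"
| ctxt: "irstep R s t \<Longrightarrow> irstep R (Fun f (us @ s # vs)) (Fun f (us @ t # vs))"

definition completely_defined ::
  "'f set \<Rightarrow> 'f set \<Rightarrow> ('f \<Rightarrow> nat option) \<Rightarrow> ('f, 'v) trs \<Rightarrow> bool" where
  "completely_defined D C ar R \<longleftrightarrow>
    (\<forall>t\<in>terms (D \<union> C) ar. vars t = {} \<longrightarrow> normal_form R t \<longrightarrow> funs t \<inter> D = {})"

(* Lengths are taken in enat: unbounded derivations give \<infinity>, and a finite supremum of a
   nonempty set is a maximum. *)
definition dh :: "('a \<Rightarrow> 'a \<Rightarrow> bool) \<Rightarrow> 'a \<Rightarrow> enat" where
  "dh step t = (SUP n\<in>{n. \<exists>u. (step ^^ n) t u}. enat n)"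

definition basic_terms :: "'f set \<Rightarrow> 'f set \<Rightarrow> ('f \<Rightarrow> nat option) \<Rightarrow> ('f, 'v) trm set" where
  "basic_terms D C ar =
    {Fun f ts | f ts. f \<in> D \<and> Fun f ts \<in> terms (D \<union> C) ar \<and> set ts \<subseteq> terms C ar}"

definition innermost_rc ::
  "'f set \<Rightarrow> 'f set \<Rightarrow> ('f \<Rightarrow> nat option) \<Rightarrow> ('f, 'v) trs \<Rightarrow> nat \<Rightarrow> enat" where
  "innermost_rc D C ar R m =
    (SUP t\<in>{t \<in> basic_terms D C ar. tsize t \<le> m}. dh (irstep R) t)"

definition normal_rc ::
  "'f set \<Rightarrow> 'f set \<Rightarrow> ('f \<Rightarrow> nat option) \<Rightarrow> ('f \<Rightarrow> nat set) \<Rightarrow> ('f, 'v) trs \<Rightarrow> nat \<Rightarrow> enat" where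
  "normal_rc D C ar safe R m =
    (SUP t\<in>{Fun f ts | f ts. Fun f ts \<in> basic_terms D C ar \<and>
                (\<Sum>u\<leftarrow>normal_args safe f ts. tsize u) \<le> m}. dh (irstep R) t)"

definition poly_bounded :: "(nat \<Rightarrow> enat) \<Rightarrow> bool" where
  "poly_bounded h \<longleftrightarrow> (\<exists>p :: nat poly. \<forall>m. h m \<le> enat (poly p m))"

end

theory Submission
  imports Defs
begin

text \<open>On constructor terms the path order is the proper superterm relation.  Hence a right-hand side
  contains at most one recursive call, below safe positions only, whose arguments are subterms of
  the arguments on the left and whose normal arguments decrease as a multiset.  A left-hand side has
  at most some fixed number \<open>K\<close> of arguments, so if the normal arguments have depth at most
  \<open>M\<close>, the recursion goes through at most \<open>(M + 2) ^ K\<close> calls.  By induction on the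
  precedence, a call of \<open>f\<close> on normal forms takes at most \<open>p(M)\<close> steps, and the result
  has depth at most \<open>p(M) + S\<close>, where \<open>S\<close> bounds the depth of the safe arguments.
  This estimate composes: normal positions only receive terms of depth polynomial in \<open>M\<close>, and
  the depth of a safe argument enters with factor one.\<close>

section \<open>Step bounds for innermost derivations\<close>

text \<open>A single predicate bounds the length of all innermost derivations from \<open>t\<close>
  and constrains the normal forms they reach, so that step counts and depth estimates compose
  together.\<close>

primrec ends_within ::
  "('f, 'v) trs \<Rightarrow> nat \<Rightarrow> (('f, 'v) trm \<Rightarrow> bool) \<Rightarrow> ('f, 'v) trm \<Rightarrow> bool" where
  "ends_within R 0 P t \<longleftrightarrow> normal_form R t \<and> P t"
| "ends_within R (Suc n) P t \<longleftrightarrow>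
    (normal_form R t \<longrightarrow> P t) \<and> (\<forall>u. irstep R t u \<longrightarrow> ends_within R n P u)"

lemma irstep_imp_rstep: "irstep R s t \<Longrightarrow> rstep R s t"
  by (induction rule: irstep.induct) (auto intro: rstep.intros)

lemma normal_form_no_irstep: "normal_form R t \<Longrightarrow> \<not> irstep R t u"
  unfolding normal_form_def using irstep_imp_rstep by blast

lemma rstep_Fun_arg: "s \<in> set ss \<Longrightarrow> rstep R s t \<Longrightarrow> \<exists>u. rstep R (Fun f ss) u"
  by (metis split_list rstep.ctxt)

lemma normal_form_arg: "normal_form R (Fun f ss) \<Longrightarrow> s \<in> set ss \<Longrightarrow> normal_form R s"
  unfolding normal_form_def by (metis rstep_Fun_arg)

lemma normal_form_supt: "s \<rhd> t \<Longrightarrow> normal_form R s \<Longrightarrow> normal_form R t"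
  by (induction rule: supt.induct) (auto dest: normal_form_arg)

lemma ends_within_normal_form: "normal_form R t \<Longrightarrow> P t \<Longrightarrow> ends_within R n P t"
  by (cases n) (auto dest: normal_form_no_irstep)

lemma ends_within_normal_formD: "ends_within R n P t \<Longrightarrow> normal_form R t \<Longrightarrow> P t"
  by (cases n) auto

lemma ends_within_mono:
  "ends_within R n P t \<Longrightarrow> n \<le> m \<Longrightarrow> (\<And>u. P u \<Longrightarrow> Q u) \<Longrightarrow> ends_within R m Q t"
proof (induction n arbitrary: t m)
  case 0
  then show ?case by (auto intro: ends_within_normal_form)
next
  case (Suc n)
  then obtain k where "m = Suc k" "n \<le> k" by (cases m) auto
  with Suc show ?case by auto
qed

lemma ends_within_relpowp: "ends_within R n P t \<Longrightarrow> (irstep R ^^ k) t u \<Longrightarrow> k \<le> n"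
proof (induction n arbitrary: t k)
  case 0
  then have "\<not> irstep R t v" for v by (auto dest: normal_form_no_irstep)
  with 0 show ?case by (cases k) (auto dest!: relpowp_Suc_D2 simp del: relpowp.simps)
next
  case (Suc n)
  show ?case
  proof (cases k)
    case (Suc j)
    with Suc.prems(2) obtain v where "irstep R t v" "(irstep R ^^ j) v u"
      by (auto dest!: relpowp_Suc_D2 simp del: relpowp.simps)
    with Suc.IH Suc.prems(1) Suc show ?thesis by auto
  qed simp
qed

lemma ends_within_dh: "ends_within R n P t \<Longrightarrow> dh (irstep R) t \<le> enat n"
  unfolding dh_def by (auto intro!: SUP_least dest: ends_within_relpowp)

text \<open>Steps in different arguments may interleave, but each uses up one unit of the budget
  \<open>c i\<close> of its argument, and an innermost root step has to wait until all arguments are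
  normal. Hence the induction on the sum of the budgets.\<close>

lemma ends_within_args:
  assumes "\<forall>i<length ts. ends_within R (c i) (Q i) (ts ! i)"
    and "\<And>vs. length vs = length ts \<Longrightarrow>
      \<forall>i<length ts. normal_form R (vs ! i) \<and> Q i (vs ! i) \<Longrightarrow> ends_within R n P (Fun g vs)"
  shows "ends_within R ((\<Sum>i<length ts. c i) + n) P (Fun g ts)"
  using assms
proof (induction "\<Sum>i<length ts. c i" arbitrary: c ts rule: less_induct)
  case less
  show ?case
  proof (cases "\<forall>s\<in>set ts. normal_form R s")
    case True
    then have "\<forall>i<length ts. normal_form R (ts ! i) \<and> Q i (ts ! i)"
      using less.prems(1) ends_within_normal_formD by (metis nth_mem)
    then have "ends_within R n P (Fun g ts)" using less.prems(2)[of ts] by blast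
    then show ?thesis by (rule ends_within_mono) auto
  next
    case False
    then obtain j where j: "j < length ts" "\<not> normal_form R (ts ! j)"
      by (metis in_set_conv_nth)
    then have "c j > 0" using less.prems(1) by (cases "c j") auto
    then have "(\<Sum>i<length ts. c i) > 0" 
      using j(1) member_le_sum[of j "{..<length ts}" c] by simp
    then obtain k where k: "(\<Sum>i<length ts. c i) = Suc k" using gr0_implies_Suc by blast
    have "ends_within R (k + n) P u" if "irstep R (Fun g ts) u" for u
      using that
    proof (cases rule: irstep.cases)
      case (root l r \<sigma>)
      \<comment> \<open>An innermost root step would need this argument to be normal
        already.\<close>
      moreover have "Fun g ts \<rhd> ts ! j" by (rule supt.arg[OF nth_mem[OF j(1)]])
      ultimately show ?thesis using j(2) by metis
    next
      case (ctxt s t us vs)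
      let ?i = "length us" and ?ts = "us @ t # vs"
      have ts: "ts = us @ s # vs" and u: "u = Fun g ?ts" using ctxt by auto
      have *: "ends_within R (c ?i) (Q ?i) s"
        using less.prems(1)[rule_format, of ?i] by (simp add: ts)
      obtain m where m: "c ?i = Suc m" "ends_within R m (Q ?i) t"
        using * ctxt(3) by (cases "c ?i") (auto dest: normal_form_no_irstep)
      have "(\<Sum>i<length ts. c i) = c ?i + (\<Sum>i\<in>{..<length ts} - {?i}. c i)"
        by (rule sum.remove) (auto simp: ts)
      moreover have "(\<Sum>i<length ts. (c(?i := m)) i)
          = (c(?i := m)) ?i + (\<Sum>i\<in>{..<length ts} - {?i}. (c(?i := m)) i)"
        by (rule sum.remove) (auto simp: ts)
      moreover have "(\<Sum>i\<in>{..<length ts} - {?i}. (c(?i := m)) i)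
          = (\<Sum>i\<in>{..<length ts} - {?i}. c i)"
        by (rule sum.cong) auto
      ultimately have k': "(\<Sum>i<length ts. (c(?i := m)) i) = k" using k m by simp
      have len: "length ?ts = length ts" by (simp add: ts)
      have "ends_within R ((\<Sum>i<length ?ts. (c(?i := m)) i) + n) P (Fun g ?ts)"
      proof (rule less.hyps)
        show "(\<Sum>i<length ?ts. (c(?i := m)) i) < (\<Sum>i<length ts. c i)"
          using k k' len by simp
        show "\<forall>i<length ?ts. ends_within R ((c(?i := m)) i) (Q i) (?ts ! i)"
        proof (intro allI impI)
          fix i assume i: "i < length ?ts"
          show "ends_within R ((c(?i := m)) i) (Q i) (?ts ! i)"
          proof (cases "i = ?i")
            case True
            then show ?thesis using m by simp
          next
            case False
            then have "?ts ! i = ts ! i" unfolding ts by (simp add: nth_append nth_Cons')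
            then show ?thesis using less.prems(1) False i len by auto
          qed
        qed
        show "ends_within R n P (Fun g ws)"
          if "length ws = length ?ts" "\<forall>i<length ?ts. normal_form R (ws ! i) \<and> Q i (ws ! i)" for ws
          using that len less.prems(2) by simp
      qed
      then show ?thesis by (simp only: k' len u)
    qed
    moreover have "\<not> normal_form R (Fun g ts)" using j normal_form_arg nth_mem by metis
    ultimately show ?thesis using k by simp
  qed
qed

section \<open>Subterms, depth and argument positions\<close>

lemma supt_subst: "s \<rhd> t \<Longrightarrow> subst \<sigma> s \<rhd> subst \<sigma> t"
proof (induction rule: supt.induct)
  case (arg t ts f)
  then show ?case using supt.arg[of "subst \<sigma> t" "map (subst \<sigma>) ts"] by simp
next
  case (deep s ss t f)
  then show ?case using supt.deep[of "subst \<sigma> s" "map (subst \<sigma>) ss"] by simp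
qed

text \<open>Innermost rewriting never looks inside a normal form with a defined root, so such a term
  counts as an atom.  Depth is the right measure because the size of a result can be exponential:
  safe arguments may be duplicated.\<close>

fun depth :: "'f set \<Rightarrow> ('f, 'v) trm \<Rightarrow> nat" where
  "depth D (Var x) = 0"
| "depth D (Fun f ts) = (if f \<in> D then 0 else Suc (Max (insert 0 (set (map (depth D) ts)))))"

lemma depth_Fun_le: "\<forall>t\<in>set ts. depth D t \<le> n \<Longrightarrow> depth D (Fun f ts) \<le> Suc n"
  by simp

lemma depth_arg_less: "f \<notin> D \<Longrightarrow> t \<in> set ts \<Longrightarrow> depth D t < depth D (Fun f ts)"
  by (simp add: less_Suc_eq_le)

lemma depth_le_tsize: "depth D t \<le> tsize t"
proof (induction t)
  case (Fun f ts)
  have "depth D t \<le> (\<Sum>t\<leftarrow>ts. tsize t)" if "t \<in> set ts" for t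
    using Fun[OF that] member_le_sum_list[of "tsize t" "map tsize ts"] that by fastforce
  then show ?case using depth_Fun_le[of ts D] by simp
qed simp

lemma set_normal_safe: "set ts = set (normal_args safe f ts) \<union> set (safe_args safe f ts)"
  unfolding normal_args_def safe_args_def set_nths set_conv_nth[of ts] by blast

lemma sum_list_nths_le: "(\<Sum>x\<leftarrow>nths xs A. h x) \<le> (\<Sum>x\<leftarrow>xs. h x :: nat)"
  by (induction xs arbitrary: A) (auto simp: nths_Cons intro: add_mono trans_le_add2)

lemma normal_args_map: "normal_args safe f (map h ts) = map h (normal_args safe f ts)"
  and safe_args_map: "safe_args safe f (map h ts) = map h (safe_args safe f ts)"
  unfolding normal_args_def safe_args_def by (rule nths_map)+

section \<open>Counting bounded multisets\<close>

text \<open>Padding with the extra value \<open>Suc M\<close> turns a multiset of at most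
  \<open>K\<close> numbers up to \<open>M\<close> into a list of length exactly \<open>K\<close>
  over \<open>M + 2\<close> letters; filtering recovers the multiset.\<close>

lemma card_multisets_le:
  "finite {N :: nat multiset. size N \<le> K \<and> set_mset N \<subseteq> {..M}}" (is "finite ?A")
  "card {N :: nat multiset. size N \<le> K \<and> set_mset N \<subseteq> {..M}} \<le> (M + 2) ^ K"
proof -
  let ?L = "{xs. set xs \<subseteq> {..Suc M} \<and> length xs = K}"
  have L: "finite ?L" "card ?L = (M + 2) ^ K"
    by (auto simp: finite_lists_length_eq card_lists_length_eq)
  have sub: "?A \<subseteq> (\<lambda>xs. mset (filter (\<lambda>x. x \<le> M) xs)) ` ?L"
  proof
    fix N :: "nat multiset" assume N: "N \<in> ?A"
    obtain xs where xs: "mset xs = N" using ex_mset by blast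
    let ?ys = "xs @ replicate (K - length xs) (Suc M)"
    have "set xs \<subseteq> {..M}" "length xs \<le> K" using N xs by auto
    then have "?ys \<in> ?L" "filter (\<lambda>x. x \<le> M) ?ys = xs" by (auto simp: filter_id_conv)
    with xs show "N \<in> (\<lambda>xs. mset (filter (\<lambda>x. x \<le> M) xs)) ` ?L"
      by (intro image_eqI[of _ _ ?ys]) auto
  qed
  show "finite ?A" using finite_subset[OF sub] L by blast
  show "card ?A \<le> (M + 2) ^ K" using surj_card_le[OF L(1) sub] L by simp
qed

text \<open>Replaces the well-founded descent of multisets by a counter that is polynomial in
  \<open>M\<close> for fixed \<open>K\<close>.\<close>

definition mrank :: "nat \<Rightarrow> nat \<Rightarrow> nat multiset \<Rightarrow> nat" where
  "mrank K M N = card {N'. (size N' \<le> K \<and> set_mset N' \<subseteq> {..M}) \<and> N' < N}"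

text \<open>By transitivity everything counted for \<open>N\<close> is counted for
  \<open>N'\<close>, and \<open>N\<close> itself is counted only for \<open>N'\<close>.\<close>

lemma mrank_less:
  assumes "N < N'" "size N \<le> K" "set_mset N \<subseteq> {..M}"
  shows "mrank K M N < mrank K M N'"
  unfolding mrank_def
proof (rule psubset_card_mono)
  show "finite {N. (size N \<le> K \<and> set_mset N \<subseteq> {..M}) \<and> N < N'}"
    by (rule finite_subset[OF _ card_multisets_le(1)[of K M]]) auto
qed (use assms in auto)

lemma mrank_le: "mrank K M N \<le> (M + 2) ^ K"
  unfolding mrank_def
  by (rule order.trans[OF card_mono[OF card_multisets_le(1)] card_multisets_le(2)]) auto

section \<open>The path order on constructor terms\<close>

locale pop_trs =
  fixes D C :: "'f set"
    and ar :: "'f \<Rightarrow> nat option"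
    and gt :: "'f \<Rightarrow> 'f \<Rightarrow> bool"
    and safe :: "'f \<Rightarrow> nat set"
    and R :: "('f, 'v) trs"
  assumes disjoint: "D \<inter> C = {}"
    and finite_R: "finite R"
    and constructor_trs: "constructor_trs D C ar R"
    and precedence: "precedence (D \<union> C) gt"
    and safe_mapping: "safe_mapping D C ar safe"
    and oriented: "\<forall>(l, r)\<in>R. pop D C gt safe l r"
begin

abbreviation "NF \<equiv> normal_form R"
abbreviation "dep \<equiv> depth D"

lemma rule_lhs:
  assumes "(l, r) \<in> R"
  obtains f ss where "l = Fun f ss" "f \<in> D" "\<forall>s\<in>set ss. s \<in> terms C ar"
  using assms constructor_trs unfolding constructor_trs_def by blast

lemma constructor_term_Fun:
  assumes "Fun c ss \<in> terms C ar"
  shows "c \<in> C" "c \<notin> D" "\<forall>s\<in>set ss. s \<in> terms C ar" "normal_args safe c ss = []"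
proof -
  show c: "c \<in> C" "\<forall>s\<in>set ss. s \<in> terms C ar"
    using assms by (auto elim: terms.cases)
  then show "c \<notin> D" using disjoint by blast
  have "ar c = None \<or> ar c = Some (length ss)" using assms by (auto elim: terms.cases)
  then have "\<forall>i<length ss. i \<in> safe c"
    using safe_mapping c(1) unfolding safe_mapping_def by (auto split: option.splits)
  then have "set (normal_args safe c ss) = {}"
    unfolding normal_args_def set_nths by auto
  then show "normal_args safe c ss = []" by simp
qed

text \<open>All positions of a constructor are safe and its symbol is not defined, so only the
  clause for constructors can apply.\<close>

lemma sqgt_constructor_term: "sqgt D C gt safe s t \<Longrightarrow> s \<in> terms C ar \<Longrightarrow> s \<rhd> t"
proof (induction s arbitrary: t)
  case (Fun c ss)
  note c = constructor_term_Fun[OF Fun.prems(2)]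
  from Fun.prems(1) show ?case
    by (cases rule: sqgt.cases) (use c Fun.IH in \<open>auto intro: supt.intros\<close>)
qed (auto elim: sqgt.cases)

text \<open>The multiset clause cannot apply: it demands a strict decrease of the normal arguments,
  and under a constructor there are none.\<close>

lemma pop_constructor_term: "pop D C gt safe s t \<Longrightarrow> s \<in> terms C ar \<Longrightarrow> s \<rhd> t"
proof (induction s arbitrary: t)
  case (Fun c ss)
  note c = constructor_term_Fun[OF Fun.prems(2)]
  from Fun.prems(1) show ?case
  proof (cases rule: pop.cases)
    case sq
    then show ?thesis using sqgt_constructor_term Fun.prems(2) by blast
  next
    case (mul ts)
    then show ?thesis using c(4) unfolding mul_gt_def multp\<^sub>D\<^sub>M_def by auto
  qed (use c Fun.IH in \<open>auto intro: supt.intros\<close>)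
qed (auto elim: pop.cases)

text \<open>Only constructors lie on the path from the root of \<open>s\<close> to \<open>t\<close>,
  and each of them raises the depth by at least one.\<close>

lemma depth_subst_supt:
  "s \<rhd> t \<Longrightarrow> s \<in> terms C ar \<Longrightarrow> dep (subst \<sigma> t) < dep (subst \<sigma> s)"
proof (induction rule: supt.induct)
  case (arg t ts f)
  then show ?case using constructor_term_Fun[OF arg(2)]
    using depth_arg_less[of f D "subst \<sigma> t" "map (subst \<sigma>) ts"] by simp
next
  case (deep s ss t f)
  note c = constructor_term_Fun[OF deep.prems]
  have "dep (subst \<sigma> t) < dep (subst \<sigma> s)" using deep c by blast
  also have "\<dots> < dep (subst \<sigma> (Fun f ss))"
    using depth_arg_less[of f D "subst \<sigma> s" "map (subst \<sigma>) ss"] deep c by simp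
  finally show ?case .
qed

text \<open>These are finitely many because \<open>R\<close> is finite, whereas \<open>D\<close> may
  be infinite.\<close>

definition root_symbols :: "'f set" where
  "root_symbols = {f. \<exists>ss r. (Fun f ss, r) \<in> R}"

lemma root_step:
  assumes "rstep R (Fun f vs) u" "\<forall>v\<in>set vs. NF v"
  obtains ss r \<sigma> where "(Fun f ss, r) \<in> R" "vs = map (subst \<sigma>) ss" "u = subst \<sigma> r"
  using assms(1)
proof (cases rule: rstep.cases)
  case (root l r \<sigma>)
  then obtain ss where "l = Fun f ss" by (metis rule_lhs subst.simps(2) trm.inject(2))
  with root that show ?thesis by auto
next
  case (ctxt s t us ws)
  then show ?thesis using assms(2) unfolding normal_form_def by auto
qed

lemma normal_form_no_root:
  assumes "\<forall>v\<in>set vs. NF v" "f \<notin> root_symbols"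
  shows "NF (Fun f vs)"
  unfolding normal_form_def using assms root_step unfolding root_symbols_def by blast

lemma root_symbols_defined: "root_symbols \<subseteq> D"
  unfolding root_symbols_def using rule_lhs by blast

lemma constructor_term_normal_form: "t \<in> terms C ar \<Longrightarrow> NF t"
proof (induction t)
  case (Var x)
  have "\<not> rstep R (Var x) u" for u
  proof
    assume "rstep R (Var x) u"
    then show False
      by (cases rule: rstep.cases) (metis rule_lhs subst.simps(2) trm.distinct(1))
  qed
  then show ?case unfolding normal_form_def by blast
next
  case (Fun c ts)
  note c = constructor_term_Fun[OF Fun.prems]
  show ?case by (rule normal_form_no_root) (use c Fun.IH root_symbols_defined in auto)
qed

section \<open>Polynomial bounds for symbols and right-hand sides\<close>

text \<open>The invariant of the whole argument: \<open>p\<close> is evaluated only at the bound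
  \<open>M\<close> for normal arguments, while the bound \<open>S\<close> for safe ones does not
  affect the number of steps and is merely added to the depth of the result.\<close>

definition poly_symbol :: "'f \<Rightarrow> nat poly \<Rightarrow> bool" where
  "poly_symbol f p \<longleftrightarrow> (\<forall>vs M S. (\<forall>v\<in>set vs. NF v) \<longrightarrow>
    (\<forall>v\<in>set (normal_args safe f vs). dep v \<le> M) \<longrightarrow>
    (\<forall>v\<in>set (safe_args safe f vs). dep v \<le> S) \<longrightarrow>
    ends_within R (poly p M) (\<lambda>u. dep u \<le> poly p M + S) (Fun f vs))"

lemma poly_symbol_no_root:
  assumes "f \<notin> root_symbols"
  shows "poly_symbol f [:1, 1:]"
  unfolding poly_symbol_def
proof (intro allI impI)
  fix vs M S
  assume "\<forall>v\<in>set vs. NF v" and M: "\<forall>v\<in>set (normal_args safe f vs). dep v \<le> M"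
    and S: "\<forall>v\<in>set (safe_args safe f vs). dep v \<le> S"
  then have NF: "NF (Fun f vs)" using assms normal_form_no_root by blast
  have "\<forall>v\<in>set vs. dep v \<le> M + S"
    using M S set_normal_safe[of vs safe f] by (auto intro: trans_le_add1 trans_le_add2)
  then have "dep (Fun f vs) \<le> Suc (M + S)" by (rule depth_Fun_le)
  then show "ends_within R (poly [:1, 1:] M) (\<lambda>u. dep u \<le> poly [:1, 1:] M + S) (Fun f vs)"
    using NF by (intro ends_within_normal_form) auto
qed

text \<open>Describes the matching substitution at a root step, with \<open>M\<close> and
  \<open>S\<close> in the same roles as in \<open>poly_symbol\<close>. Recursive calls preserve
  it.\<close>

definition normalizing :: "('v \<Rightarrow> ('f, 'v) trm) \<Rightarrow> 'f \<Rightarrow> ('f, 'v) trm list \<Rightarrow> nat \<Rightarrow> nat \<Rightarrow> bool" where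
  "normalizing \<sigma> f ss M S \<longleftrightarrow> (\<forall>s\<in>set ss. NF (subst \<sigma> s)) \<and>
    (\<forall>s\<in>set (normal_args safe f ss). dep (subst \<sigma> s) \<le> M) \<and>
    (\<forall>s\<in>set (safe_args safe f ss). dep (subst \<sigma> s) \<le> S)"

lemma normalizing_supt:
  assumes "normalizing \<sigma> f ss M S" "Fun f ss \<rhd> t" "\<forall>s\<in>set ss. s \<in> terms C ar"
  shows "NF (subst \<sigma> t)" "dep (subst \<sigma> t) \<le> M + S"
proof -
  obtain s where s: "s \<in> set ss" "s = t \<or> s \<rhd> t" using assms(2) by (auto elim: supt.cases)
  then show "NF (subst \<sigma> t)"
    using assms(1) normal_form_supt supt_subst unfolding normalizing_def by blast
  have "dep (subst \<sigma> t) \<le> dep (subst \<sigma> s)"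
    using s depth_subst_supt assms(3) by (metis nat_less_le order_refl)
  moreover have "dep (subst \<sigma> s) \<le> M + S"
    using s(1) set_normal_safe[of ss safe f] assms(1) unfolding normalizing_def
    by (auto intro: trans_le_add1 trans_le_add2)
  ultimately show "dep (subst \<sigma> t) \<le> M + S" by simp
qed

text \<open>Such a term is built from subterms of normal arguments by symbols smaller than
  \<open>f\<close>. Hence neither \<open>S\<close> nor a recursive call enters the bound, and nested
  calls compose polynomials in \<open>M\<close>. This makes the term fit for normal
  positions.\<close>

lemma sqgt_poly:
  assumes "f \<in> D" "\<forall>s\<in>set ss. s \<in> terms C ar"
    and "\<And>g. g \<in> funs t \<Longrightarrow> gt f g \<Longrightarrow> \<exists>p. poly_symbol g p"
    and "sqgt D C gt safe (Fun f ss) t"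
  shows "\<exists>q. \<forall>\<sigma> M S. normalizing \<sigma> f ss M S \<longrightarrow>
    ends_within R (poly q M) (\<lambda>u. dep u \<le> poly q M) (subst \<sigma> t)"
  using assms(3,4)
proof (induction t)
  have normal_term: "ends_within R (poly [:0, 1:] M) (\<lambda>u. dep u \<le> poly [:0, 1:] M) (subst \<sigma> t)"
    if s: "s \<in> set (normal_args safe f ss)" "s = t \<or> sqgt D C gt safe s t"
      and N: "normalizing \<sigma> f ss M S" for s t \<sigma> M S
  proof -
    have ss: "s \<in> set ss" using s set_normal_safe[of ss safe f] by blast
    then have st: "s = t \<or> s \<rhd> t" using s assms(2) sqgt_constructor_term by blast
    then have "dep (subst \<sigma> t) \<le> dep (subst \<sigma> s)"
      using ss depth_subst_supt assms(2) by (metis nat_less_le order_refl)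
    also have "\<dots> \<le> M" using N s unfolding normalizing_def by blast
    finally have "dep (subst \<sigma> t) \<le> M" .
    moreover have "NF (subst \<sigma> t)"
      using normalizing_supt[OF N _ assms(2)] st ss by (auto intro: supt.intros)
    ultimately show ?thesis by (intro ends_within_normal_form) auto
  qed
  {
    case (Var x)
    from Var.prems(2) obtain s where
      "s \<in> set (normal_args safe f ss)" "s = Var x \<or> sqgt D C gt safe s (Var x)"
      using assms(1) disjoint by (cases rule: sqgt.cases) auto
    then show ?case using normal_term by blast
  next
    case (Fun g ts)
    from Fun.prems(2) consider
      (normal) s where "s \<in> set (normal_args safe f ss)"
        "s = Fun g ts \<or> sqgt D C gt safe s (Fun g ts)"
      | (prec) "gt f g" "\<forall>t\<in>set ts. sqgt D C gt safe (Fun f ss) t"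
      using assms(1) disjoint by (cases rule: sqgt.cases) auto
    then show ?case
    proof cases
      case (normal s)
      then show ?thesis using normal_term by blast
    next
      case prec
      obtain p where p: "poly_symbol g p" using Fun.prems(1)[of g] prec(1) by auto
      have funs: "h \<in> funs (ts ! i) \<Longrightarrow> gt f h \<Longrightarrow> \<exists>p. poly_symbol h p"
        if "i < length ts" for i h
        using Fun.prems(1) that by (auto dest: nth_mem)
      have "\<exists>q. \<forall>\<sigma> M S. normalizing \<sigma> f ss M S \<longrightarrow>
          ends_within R (poly q M) (\<lambda>u. dep u \<le> poly q M) (subst \<sigma> (ts ! i))"
        if "i < length ts" for i
        by (rule Fun.IH[OF nth_mem[OF that] funs[OF that] prec(2)[rule_format, OF nth_mem[OF that]]])
      then obtain q where q: "normalizing \<sigma> f ss M S \<Longrightarrow>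
          ends_within R (poly (q i) M) (\<lambda>u. dep u \<le> poly (q i) M) (subst \<sigma> (ts ! i))"
        if "i < length ts" for i \<sigma> M S by metis
      define qs where "qs = (\<Sum>i<length ts. q i)"
      have qs: "poly qs M = (\<Sum>i<length ts. poly (q i) M)" for M
        by (simp add: qs_def poly_sum)
      have "ends_within R (poly (qs + qs + pcompose p qs) M)
          (\<lambda>u. dep u \<le> poly (qs + qs + pcompose p qs) M) (subst \<sigma> (Fun g ts))"
        if N: "normalizing \<sigma> f ss M S" for \<sigma> M S
      proof -
        have "ends_within R ((\<Sum>i<length (map (subst \<sigma>) ts). poly (q i) M) + poly p (poly qs M))
          (\<lambda>u. dep u \<le> poly p (poly qs M) + poly qs M) (Fun g (map (subst \<sigma>) ts))"
        proof (rule ends_within_args[where Q = "\<lambda>i u. dep u \<le> poly (q i) M"])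
          show "\<forall>i<length (map (subst \<sigma>) ts). ends_within R (poly (q i) M)
              (\<lambda>u. dep u \<le> poly (q i) M) (map (subst \<sigma>) ts ! i)"
            using q N by auto
          fix vs assume len: "length vs = length (map (subst \<sigma>) ts)"
            and vs: "\<forall>i<length (map (subst \<sigma>) ts). NF (vs ! i) \<and> dep (vs ! i) \<le> poly (q i) M"
          have "dep (vs ! i) \<le> poly qs M" if "i < length ts" for i
            using vs that member_le_sum[of i "{..<length ts}" "\<lambda>i. poly (q i) M"]
            unfolding qs by fastforce
          then have "\<forall>v\<in>set vs. NF v \<and> dep v \<le> poly qs M"
            using vs len by (auto simp: in_set_conv_nth)
          \<comment> \<open>The common bound \<open>poly qs M\<close> serves for the normal and for
            the safe arguments of \<open>g\<close>.\<close>
          then show "ends_within R (poly p (poly qs M))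
              (\<lambda>u. dep u \<le> poly p (poly qs M) + poly qs M) (Fun g vs)"
            using p set_normal_safe[of vs safe g] unfolding poly_symbol_def by blast
        qed
        then show ?thesis
          by (auto simp: qs[symmetric] poly_pcompose elim!: ends_within_mono)
      qed
      then show ?thesis by blast
    qed
  }
qed

text \<open>The premises of the clause \<open>pop.mul\<close>, isolated so that the bound for a
  right-hand side can take a bound \<open>n\<close> on recursive calls as a parameter.\<close>

definition recursive_call :: "'f \<Rightarrow> ('f, 'v) trm list \<Rightarrow> ('f, 'v) trm list \<Rightarrow> bool" where
  "recursive_call f ss ts \<longleftrightarrow>
    mul_gt (pop D C gt safe) (mset (normal_args safe f ss)) (mset (normal_args safe f ts)) \<and>
    mul_ge (pop D C gt safe) (mset (safe_args safe f ss)) (mset (safe_args safe f ts))"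

text \<open>The clauses of the path order other than the one for the same root symbol leave a single safe
  position in which to descend, so a right-hand side contains at most one recursive call.\<close>

lemma pop_poly:
  assumes "f \<in> D" "\<forall>s\<in>set ss. s \<in> terms C ar"
    and "\<And>g. g \<in> funs t \<Longrightarrow> gt f g \<Longrightarrow> \<exists>p. poly_symbol g p"
    and "pop D C gt safe (Fun f ss) t"
  shows "\<exists>q. \<forall>\<sigma> M S n. normalizing \<sigma> f ss M S \<longrightarrow>
    (\<forall>ts. recursive_call f ss ts \<longrightarrow>
      ends_within R n (\<lambda>u. dep u \<le> n + S) (Fun f (map (subst \<sigma>) ts))) \<longrightarrow>
    ends_within R (n + poly q M) (\<lambda>u. dep u \<le> n + poly q M + S) (subst \<sigma> t)"
    (is "\<exists>q. ?P q t")
  using assms(3,4)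
proof (induction t)
  have sq_poly: "\<exists>q. ?P q t"
    if t: "\<And>g. g \<in> funs t \<Longrightarrow> gt f g \<Longrightarrow> \<exists>p. poly_symbol g p"
      "sqgt D C gt safe (Fun f ss) t" for t
  proof -
    obtain q where q: "normalizing \<sigma> f ss M S \<Longrightarrow>
        ends_within R (poly q M) (\<lambda>u. dep u \<le> poly q M) (subst \<sigma> t)" for \<sigma> M S
      using sqgt_poly[OF assms(1,2) t] by blast
    have "?P q t" by (intro allI impI, rule ends_within_mono[OF q]) auto
    then show ?thesis by blast
  qed
  \<comment> \<open>Instances of subterms are already normal; the identity polynomial supplies the
    \<open>M\<close> in their depth bound \<open>M + S\<close>.\<close>
  have sub_poly: "?P [:0, 1:] t" if "Fun f ss \<rhd> t" for t
    using normalizing_supt[OF _ that assms(2)]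
    by (fastforce intro!: ends_within_normal_form)
  have args: "Fun f ss \<rhd> t" if "s \<in> set ss" "s = t \<or> pop D C gt safe s t" for s t
    using that assms(2) pop_constructor_term by (blast intro: supt.intros)
  {
    case (Var x)
    from Var.prems(2) show ?case
    proof (cases rule: pop.cases)
      case sq
      then show ?thesis using sq_poly Var.prems(1) by blast
    next
      case (sub s)
      then show ?thesis using args sub_poly by blast
    qed
  next
    case (Fun g ts)
    from Fun.prems(2) consider (sq) "sqgt D C gt safe (Fun f ss) (Fun g ts)"
      | (sub) "Fun f ss \<rhd> Fun g ts"
      | (prec) j where "gt f g" "j < length ts" "j \<in> safe g"
        "pop D C gt safe (Fun f ss) (ts ! j)"
        "\<forall>i<length ts. i \<noteq> j \<longrightarrow>
          sqgt D C gt safe (Fun f ss) (ts ! i) \<or> (Fun f ss \<rhd> ts ! i \<and> i \<in> safe g)"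
      | (rec) "g = f" "recursive_call f ss ts"
      unfolding recursive_call_def by (cases rule: pop.cases) (use args in blast)+
    then show ?case
    proof cases
      case sq
      then show ?thesis using sq_poly Fun.prems(1) by blast
    next
      case sub
      then show ?thesis using sub_poly by blast
    next
      case rec
      \<comment> \<open>The term is itself the recursive call, so nothing is added to
        \<open>n\<close>.\<close>
      then have "?P 0 (Fun g ts)" by simp
      then show ?thesis by blast
    next
      case (prec j)
      obtain p where p: "poly_symbol g p" using Fun.prems(1)[of g] prec(1) by auto
      have funs: "h \<in> funs (ts ! i) \<Longrightarrow> gt f h \<Longrightarrow> \<exists>p. poly_symbol h p"
        if "i < length ts" for i h
        using Fun.prems(1) that by (auto dest: nth_mem)
      \<comment> \<open>Only position \<open>j\<close> may contain the recursive call, so only it is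
        charged \<open>n\<close>, and only safe positions may depend on \<open>S\<close>.\<close>
      have "\<exists>q. \<forall>\<sigma> M S n. normalizing \<sigma> f ss M S \<longrightarrow>
        (\<forall>ts. recursive_call f ss ts \<longrightarrow>
          ends_within R n (\<lambda>u. dep u \<le> n + S) (Fun f (map (subst \<sigma>) ts))) \<longrightarrow>
        ends_within R ((if i = j then n else 0) + poly q M)
          (\<lambda>u. dep u \<le> (if i = j then n else 0) + poly q M + (if i \<in> safe g then S else 0))
          (subst \<sigma> (ts ! i))"
        (is "\<exists>q. ?Q i q") if i: "i < length ts" for i
      proof (cases "i = j")
        case True
        then obtain q where "?P q (ts ! i)" using Fun.IH[OF nth_mem[OF i] funs[OF i]] prec by blast
        then show ?thesis using True prec(3) by auto
      next
        case False
        then consider "sqgt D C gt safe (Fun f ss) (ts ! i)" | "Fun f ss \<rhd> ts ! i" "i \<in> safe g"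
          using prec(5) i by blast
        then show ?thesis
        proof cases
          case 1
          obtain q where q: "normalizing \<sigma> f ss M S \<Longrightarrow>
              ends_within R (poly q M) (\<lambda>u. dep u \<le> poly q M) (subst \<sigma> (ts ! i))" for \<sigma> M S
            using sqgt_poly[OF assms(1,2) funs[OF i] 1] by blast
          have "?Q i q" by (intro allI impI, rule ends_within_mono[OF q]) auto
          then show ?thesis by blast
        next
          case 2
          have "?Q i [:0, 1:]"
            using False 2(2) normalizing_supt[OF _ 2(1) assms(2)]
            by (fastforce intro!: ends_within_normal_form)
          then show ?thesis by blast
        qed
      qed
      then obtain q where q: "?Q i (q i)" if "i < length ts" for i by metis
      define qs where "qs = (\<Sum>i<length ts. q i)"
      have qs: "poly qs M = (\<Sum>i<length ts. poly (q i) M)" for M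
        by (simp add: qs_def poly_sum)
      have "ends_within R (n + poly (qs + pcompose p qs) M)
          (\<lambda>u. dep u \<le> n + poly (qs + pcompose p qs) M + S) (subst \<sigma> (Fun g ts))"
        if N: "normalizing \<sigma> f ss M S"
          and rec: "\<forall>ts. recursive_call f ss ts \<longrightarrow>
            ends_within R n (\<lambda>u. dep u \<le> n + S) (Fun f (map (subst \<sigma>) ts))" for \<sigma> M S n
      proof -
        let ?c = "\<lambda>i. (if i = j then n else 0) + poly (q i) M"
        have c: "(\<Sum>i<length (map (subst \<sigma>) ts). ?c i) = n + poly qs M"
          using prec(2) by (simp add: qs sum.distrib)
        have "ends_within R ((\<Sum>i<length (map (subst \<sigma>) ts). ?c i) + poly p (poly qs M))
          (\<lambda>u. dep u \<le> poly p (poly qs M) + (n + poly qs M + S)) (Fun g (map (subst \<sigma>) ts))"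
        proof (rule ends_within_args[where
              Q = "\<lambda>i u. dep u \<le> ?c i + (if i \<in> safe g then S else 0)"])
          show "\<forall>i<length (map (subst \<sigma>) ts). ends_within R (?c i)
              (\<lambda>u. dep u \<le> ?c i + (if i \<in> safe g then S else 0)) (map (subst \<sigma>) ts ! i)"
            using q N rec by simp
          fix vs assume len: "length vs = length (map (subst \<sigma>) ts)"
            and vs: "\<forall>i<length (map (subst \<sigma>) ts).
              NF (vs ! i) \<and> dep (vs ! i) \<le> ?c i + (if i \<in> safe g then S else 0)"
          have le: "poly (q i) M \<le> poly qs M" if "i < length ts" for i
            using that member_le_sum[of i "{..<length ts}" "\<lambda>i. poly (q i) M"]
            unfolding qs by simp
          \<comment> \<open>Since \<open>j\<close> is safe, a normal position carries neither
            \<open>n\<close> nor \<open>S\<close>, so \<open>p\<close> is evaluated at a polynomial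
            in \<open>M\<close> alone.\<close>
          have "dep (vs ! i) \<le> poly qs M" if "i < length ts" "i \<notin> safe g" for i
            using vs[rule_format, of i] le[of i] that prec(3) by (auto split: if_splits)
          then have "\<forall>v\<in>set (normal_args safe g vs). dep v \<le> poly qs M"
            using len unfolding normal_args_def set_nths by auto
          moreover have "dep (vs ! i) \<le> n + poly qs M + S" if "i < length ts" for i
            using vs[rule_format, of i] le[of i] that by (auto split: if_splits)
          then have "\<forall>v\<in>set (safe_args safe g vs). dep v \<le> n + poly qs M + S"
            using len unfolding safe_args_def set_nths by auto
          moreover have "\<forall>v\<in>set vs. NF v" using vs len by (auto simp: in_set_conv_nth)
          ultimately show "ends_within R (poly p (poly qs M))
              (\<lambda>u. dep u \<le> poly p (poly qs M) + (n + poly qs M + S)) (Fun g vs)"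
            using p unfolding poly_symbol_def by blast
        qed
        then show ?thesis
          unfolding c by (auto simp: poly_pcompose elim!: ends_within_mono)
      qed
      then show ?thesis by blast
    qed
  }
qed

section \<open>Descent through recursive calls\<close>

text \<open>Each term added is a proper subterm of a term removed, so its instance has smaller
  depth. A Dershowitz-Manna decomposition of the arguments thus maps to one of their depths.\<close>

lemma mul_gt_constructor_terms:
  assumes "mul_gt (pop D C gt safe) (mset ss) (mset ts)" "\<forall>s\<in>set ss. s \<in> terms C ar"
  shows "\<forall>t\<in>set ts. \<exists>s\<in>set ss. s = t \<or> s \<rhd> t"
    and "mset (map (\<lambda>t. dep (subst \<sigma> t)) ts) < mset (map (\<lambda>t. dep (subst \<sigma> t)) ss)"
proof -
  obtain X Y where XY: "X \<noteq> {#}" "X \<subseteq># mset ss" "mset ts = mset ss - X + Y"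
    and *: "\<forall>k. k \<in># Y \<longrightarrow> (\<exists>a. a \<in># X \<and> pop D C gt safe a k)"
    using assms(1) unfolding mul_gt_def multp\<^sub>D\<^sub>M_def by blast
  have X: "a \<in> set ss" if "a \<in># X" for a using that XY(2) mset_subset_eqD by fastforce
  with * assms(2) have Y: "\<exists>a. a \<in># X \<and> a \<rhd> k" if "k \<in># Y" for k
    using that pop_constructor_term by blast
  have "\<exists>s\<in>set ss. s = t \<or> s \<rhd> t" if "t \<in> set ts" for t
  proof -
    have "t \<in># mset ss - X + Y" using that XY(3) by (metis set_mset_mset)
    then have "t \<in> set ss \<or> t \<in># Y" by (auto dest: in_diffD)
    then show ?thesis using X Y by blast
  qed
  then show "\<forall>t\<in>set ts. \<exists>s\<in>set ss. s = t \<or> s \<rhd> t" by blast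
  let ?h = "\<lambda>t. dep (subst \<sigma> t)"
  have "image_mset ?h (mset ts) = image_mset ?h (mset ss) - image_mset ?h X + image_mset ?h Y"
    by (simp only: XY(3) image_mset_union image_mset_Diff[OF XY(2)])
  moreover have "image_mset ?h X \<noteq> {#}" "image_mset ?h X \<subseteq># image_mset ?h (mset ss)"
    using XY by (auto intro: image_mset_subseteq_mono)
  moreover have "\<forall>k. k \<in># image_mset ?h Y \<longrightarrow> (\<exists>a. a \<in># image_mset ?h X \<and> k < a)"
    using Y X assms(2) depth_subst_supt by fastforce
  ultimately have "image_mset ?h (mset ts) < image_mset ?h (mset ss)"
    unfolding less_multiset\<^sub>D\<^sub>M by blast
  then show "mset (map ?h ts) < mset (map ?h ss)" by simp
qed

text \<open>Each argument of the call equals or is a subterm of an argument on the left, normal from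
  normal and safe from safe; so \<open>M\<close> and \<open>S\<close> remain valid while the
  multiset of normal depths falls.\<close>

lemma recursive_call_args:
  assumes "normalizing \<sigma> f ss M S" "\<forall>s\<in>set ss. s \<in> terms C ar" "recursive_call f ss ts"
  shows "normalizing \<sigma> f ts M S"
    and "mset (map (\<lambda>t. dep (subst \<sigma> t)) (normal_args safe f ts))
      < mset (map (\<lambda>t. dep (subst \<sigma> t)) (normal_args safe f ss))"
proof -
  have C: "\<forall>s\<in>set (normal_args safe f ss). s \<in> terms C ar"
    "\<forall>s\<in>set (safe_args safe f ss). s \<in> terms C ar"
    using assms(2) set_normal_safe[of ss safe f] by auto
  have gt: "mul_gt (pop D C gt safe) (mset (normal_args safe f ss)) (mset (normal_args safe f ts))"
    and ge: "mul_ge (pop D C gt safe) (mset (safe_args safe f ss)) (mset (safe_args safe f ts))"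
    using assms(3) unfolding recursive_call_def by auto
  show "mset (map (\<lambda>t. dep (subst \<sigma> t)) (normal_args safe f ts))
      < mset (map (\<lambda>t. dep (subst \<sigma> t)) (normal_args safe f ss))"
    by (rule mul_gt_constructor_terms(2)[OF gt C(1)])
  have n: "\<forall>t\<in>set (normal_args safe f ts). \<exists>s\<in>set (normal_args safe f ss). s = t \<or> s \<rhd> t"
    by (rule mul_gt_constructor_terms(1)[OF gt C(1)])
  have s: "\<forall>t\<in>set (safe_args safe f ts). \<exists>s\<in>set (safe_args safe f ss). s = t \<or> s \<rhd> t"
    using ge mul_gt_constructor_terms(1)[OF _ C(2)] unfolding mul_ge_def
    by (metis mset_eq_setD)
  have dep: "dep (subst \<sigma> t) \<le> m"
    if "s = t \<or> s \<rhd> t" "dep (subst \<sigma> s) \<le> m" "s \<in> terms C ar" for s t m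
    using that depth_subst_supt[of s t \<sigma>] by auto
  have "NF (subst \<sigma> t)" if t: "t \<in> set ts" for t
  proof -
    have "t \<in> set (normal_args safe f ts) \<or> t \<in> set (safe_args safe f ts)"
      using t set_normal_safe[of ts safe f] by blast
    with n s obtain s where "s \<in> set ss" "s = t \<or> s \<rhd> t"
      using set_normal_safe[of ss safe f] by blast
    then show ?thesis
      using assms(1) normal_form_supt supt_subst unfolding normalizing_def by blast
  qed
  moreover have "\<forall>t\<in>set (normal_args safe f ts). dep (subst \<sigma> t) \<le> M"
    using n dep C(1) assms(1) unfolding normalizing_def by blast
  moreover have "\<forall>t\<in>set (safe_args safe f ts). dep (subst \<sigma> t) \<le> S"
    using s dep C(2) assms(1) unfolding normalizing_def by blast
  ultimately show "normalizing \<sigma> f ts M S" unfolding normalizing_def by blast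
qed

text \<open>Apart from its recursive call, unfolding \<open>f\<close> once costs at most a fixed
  polynomial in \<open>M\<close>, obtained from the bounds for smaller symbols. Along the recursive
  calls \<open>M\<close> stays fixed and \<open>mrank\<close> falls, which limits the number of
  unfoldings.\<close>

lemma poly_symbol_rec:
  assumes f: "f \<in> D"
    and below: "\<And>l r g. (l, r) \<in> R \<Longrightarrow> g \<in> funs r \<Longrightarrow> gt f g \<Longrightarrow> \<exists>p. poly_symbol g p"
  shows "\<exists>p. poly_symbol f p"
proof -
  have constr: "\<forall>s\<in>set ss. s \<in> terms C ar" if "(Fun f ss, r) \<in> R" for ss r
    using rule_lhs[OF that] by blast
  define P where "P ss r q \<longleftrightarrow> (\<forall>\<sigma> M S n. normalizing \<sigma> f ss M S \<longrightarrow>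
    (\<forall>ts. recursive_call f ss ts \<longrightarrow>
      ends_within R n (\<lambda>u. dep u \<le> n + S) (Fun f (map (subst \<sigma>) ts))) \<longrightarrow>
    ends_within R (n + poly q M) (\<lambda>u. dep u \<le> n + poly q M + S) (subst \<sigma> r))" for ss r q
  have "\<exists>q. P ss r q" if "(Fun f ss, r) \<in> R" for ss r
    unfolding P_def
    using pop_poly[OF f constr[OF that] below[OF that]] that oriented by blast
  then obtain q' where q': "(Fun f ss, r) \<in> R \<Longrightarrow> P ss r (q' ss r)" for ss r
    by metis
  \<comment> \<open>Repackages the bounds as a function of the rule, so that they can be summed over
    \<open>R\<close>. The value for a variable is a default, as no left-hand side is a
    variable.\<close>
  define q where "q \<rho> = (case fst \<rho> of Var x \<Rightarrow> 0 | Fun g ss \<Rightarrow> q' ss (snd \<rho>))" for \<rho>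
  have q: "P ss r (q (Fun f ss, r))" if "(Fun f ss, r) \<in> R" for ss r
    using q'[OF that] by (simp add: q_def)
  \<comment> \<open>The summand 1 pays for the root step.\<close>
  define qs where "qs = 1 + (\<Sum>\<rho>\<in>R. q \<rho>)"
  have qs: "Suc (poly (q \<rho>) M) \<le> poly qs M" if "\<rho> \<in> R" for \<rho> M
    using member_le_sum[OF that, of "\<lambda>\<rho>. poly (q \<rho>) M"] finite_R
    by (simp add: qs_def poly_sum)
  \<comment> \<open>Bounds the number of arguments of every left-hand side and becomes the exponent
    in the count of multisets.\<close>
  define K where "K = (\<Sum>\<rho>\<in>R. length (case fst \<rho> of Var x \<Rightarrow> [] | Fun f ss \<Rightarrow> ss))"
  have K: "length ss \<le> K" if "(Fun f ss, r) \<in> R" for ss r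
    using member_le_sum[OF that, of "\<lambda>\<rho>. length (case fst \<rho> of Var x \<Rightarrow> [] | Fun f ss \<Rightarrow> ss)"]
      finite_R by (simp add: K_def)
  have normal_length: "length (normal_args safe f ss) \<le> length ss" for ss :: "('f, 'v) trm list"
    unfolding normal_args_def
    by (simp add: length_nths card_mono[of "{..<length ss}", simplified] Collect_mono subset_iff)
  \<comment> \<open>The rank condition is guarded by the length: a variadic recursive call may have
    more than \<open>K\<close> normal arguments, but then no rule matches it.\<close>
  have main: "ends_within R (k * poly qs M) (\<lambda>u. dep u \<le> k * poly qs M + S) (Fun f vs)"
    if "\<forall>v\<in>set vs. NF v"
      and "\<forall>v\<in>set (normal_args safe f vs). dep v \<le> M"
      and "\<forall>v\<in>set (safe_args safe f vs). dep v \<le> S"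
      and "length (normal_args safe f vs) \<le> K \<Longrightarrow>
        mrank K M (mset (map dep (normal_args safe f vs))) < k"
    for k vs M S
    using that
  proof (induction k arbitrary: vs)
    case 0
    have "\<not> rstep R (Fun f vs) u" for u
    proof
      assume "rstep R (Fun f vs) u"
      then obtain ss r \<sigma> where "(Fun f ss, r) \<in> R" "vs = map (subst \<sigma>) ss"
        using root_step 0(1) by metis
      then have "length (normal_args safe f vs) \<le> K"
        using K normal_length[of vs] by fastforce
      then show False using 0(4) by simp
    qed
    then have "NF (Fun f vs)" unfolding normal_form_def by blast
    \<comment> \<open>A term with a defined root has depth 0.\<close>
    then show ?case using f by simp
  next
    case (Suc k)
    have step: "ends_within R (k * poly qs M + (poly qs M - 1))
        (\<lambda>u. dep u \<le> Suc k * poly qs M + S) u"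
      if u: "irstep R (Fun f vs) u" for u
    proof -
      obtain ss r \<sigma> where rule: "(Fun f ss, r) \<in> R" and vs: "vs = map (subst \<sigma>) ss"
        and u: "u = subst \<sigma> r"
        using root_step[OF irstep_imp_rstep[OF u]] Suc.prems(1) by metis
      have N: "normalizing \<sigma> f ss M S"
        using Suc.prems(1-3) unfolding vs normalizing_def normal_args_map safe_args_map by simp
      have "length (normal_args safe f vs) \<le> K"
        using K[OF rule] normal_length[of vs] vs by simp
      then have rank: "mrank K M (mset (map dep (normal_args safe f vs))) \<le> k"
        using Suc.prems(4) by simp
      have rec: "ends_within R (k * poly qs M) (\<lambda>u. dep u \<le> k * poly qs M + S)
          (Fun f (map (subst \<sigma>) ts))" if "recursive_call f ss ts" for ts
      proof (rule Suc.IH)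
        note ts = recursive_call_args[OF N constr[OF rule] that]
        show "\<forall>v\<in>set (map (subst \<sigma>) ts). NF v"
          and M: "\<forall>v\<in>set (normal_args safe f (map (subst \<sigma>) ts)). dep v \<le> M"
          and "\<forall>v\<in>set (safe_args safe f (map (subst \<sigma>) ts)). dep v \<le> S"
          using ts(1) unfolding normalizing_def normal_args_map safe_args_map by auto
        assume "length (normal_args safe f (map (subst \<sigma>) ts)) \<le> K"
        then have "mrank K M (mset (map dep (normal_args safe f (map (subst \<sigma>) ts))))
            < mrank K M (mset (map dep (normal_args safe f vs)))"
          using M ts(2) by (intro mrank_less) (auto simp: vs normal_args_map o_def)
        with rank show "mrank K M (mset (map dep (normal_args safe f (map (subst \<sigma>) ts)))) < k"
          by simp
      qed
      have "ends_within R (k * poly qs M + poly (q (Fun f ss, r)) M)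
          (\<lambda>u. dep u \<le> k * poly qs M + poly (q (Fun f ss, r)) M + S) u"
        using q[OF rule] N rec unfolding P_def u by blast
      then show ?thesis
        using qs[OF rule, of M] by (auto elim!: ends_within_mono)
    qed
    obtain j where j: "poly qs M = Suc j" by (simp add: qs_def)
    then have k: "Suc k * poly qs M = Suc (k * poly qs M + (poly qs M - 1))" by simp
    have "ends_within R (Suc (k * poly qs M + (poly qs M - 1)))
        (\<lambda>u. dep u \<le> Suc k * poly qs M + S) (Fun f vs)"
      using step f by (simp del: mult_Suc)
    then show ?case by (simp only: k)
  qed
  \<comment> \<open>The factor \<open>[:2, 1:] ^ K\<close> evaluates to \<open>(M + 2) ^ K\<close>;
    adding 1 turns the bound on \<open>mrank\<close> into the strict one that \<open>main\<close>
    asks for.\<close>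
  have "poly_symbol f (([:2, 1:] ^ K + 1) * qs)"
    unfolding poly_symbol_def
  proof (intro allI impI)
    fix vs M S
    assume "\<forall>v\<in>set vs. NF v" "\<forall>v\<in>set (normal_args safe f vs). dep v \<le> M"
      "\<forall>v\<in>set (safe_args safe f vs). dep v \<le> S"
    moreover have "mrank K M N < (M + 2) ^ K + 1" for N
      using mrank_le[of K M N] by simp
    ultimately have "ends_within R (((M + 2) ^ K + 1) * poly qs M)
        (\<lambda>u. dep u \<le> ((M + 2) ^ K + 1) * poly qs M + S) (Fun f vs)"
      by (intro main)
    then show "ends_within R (poly (([:2, 1:] ^ K + 1) * qs) M)
        (\<lambda>u. dep u \<le> poly (([:2, 1:] ^ K + 1) * qs) M + S) (Fun f vs)"
      by (simp add: poly_power add.commute)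
  qed
  then show ?thesis by blast
qed

section \<open>Induction along the precedence\<close>

lemma funs_terms: "t \<in> terms F ar \<Longrightarrow> funs t \<subseteq> F"
  by (induction rule: terms.induct) auto

lemma finite_funs: "finite (funs (t :: ('f, 'v) trm))"
  by (induction t) auto

text \<open>The rules contain only finitely many symbols, and on these the precedence is
  well-founded, so one can induct on the number of them below \<open>f\<close>. A symbol outside the
  rules heads no left-hand side.\<close>

lemma poly_symbol_ex: "\<exists>p. poly_symbol f p"
proof -
  define Y where "Y = (\<Union>(l, r)\<in>R. funs l \<union> funs r)"
  have fin: "finite Y" unfolding Y_def using finite_R finite_funs by auto
  have "Y \<subseteq> D \<union> C"
    unfolding Y_def using constructor_trs funs_terms
    unfolding constructor_trs_def is_trs_def by fast
  then have trans: "gt f h" if "f \<in> Y" "g \<in> Y" "h \<in> Y" "gt f g" "gt g h" for f g h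
    using that precedence unfolding precedence_def transp_on_def by blast
  have irrefl: "\<not> gt f f" if "f \<in> Y" for f
    using that \<open>Y \<subseteq> D \<union> C\<close> precedence unfolding precedence_def irreflp_on_def by blast
  have "\<exists>p. poly_symbol f p" if "f \<in> Y" for f
    using that
  proof (induction "card {g \<in> Y. gt f g}" arbitrary: f rule: less_induct)
    case less
    have below: "\<exists>p. poly_symbol g p" if g: "g \<in> Y" "gt f g" for g
    proof (rule less.hyps)
      show "card {h \<in> Y. gt g h} < card {h \<in> Y. gt f h}"
      proof (rule psubset_card_mono)
        show "{h \<in> Y. gt g h} \<subset> {h \<in> Y. gt f h}"
          using g less.prems trans irrefl by blast
      qed (use fin in simp)
    qed (use g in simp)
    show ?case
    proof (cases "f \<in> root_symbols")
      case True
      then have "f \<in> D" using root_symbols_defined by blast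
      then show ?thesis by (rule poly_symbol_rec) (use below in \<open>auto simp: Y_def\<close>)
    qed (use poly_symbol_no_root in blast)
  qed
  moreover have "root_symbols \<subseteq> Y" unfolding root_symbols_def Y_def by force
  ultimately show ?thesis using poly_symbol_no_root by blast
qed

section \<open>Runtime complexity of basic terms\<close>

text \<open>The sum of the polynomials over the finitely many root symbols works for all of them,
  and a basic term with any other root is a normal form.\<close>

lemma basic_term_dh:
  "\<exists>p. \<forall>f ts m. Fun f ts \<in> basic_terms D C ar \<longrightarrow>
    (\<Sum>u\<leftarrow>normal_args safe f ts. tsize u) \<le> m \<longrightarrow> dh (irstep R) (Fun f ts) \<le> enat (poly p m)"
proof -
  obtain p where p: "poly_symbol f (p f)" for f using poly_symbol_ex by metis
  have "root_symbols \<subseteq> (\<Union>(l, r)\<in>R. funs l)" unfolding root_symbols_def by force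
  then have fin: "finite root_symbols"
    using finite_subset finite_R finite_funs by fastforce
  define ps where "ps = (\<Sum>f\<in>root_symbols. p f)"
  have ps: "poly (p f) m \<le> poly ps m" if "f \<in> root_symbols" for f m
    using member_le_sum[OF that, of "\<lambda>f. poly (p f) m"] fin by (simp add: ps_def poly_sum)
  have "dh (irstep R) (Fun f ts) \<le> enat (poly ps m)"
    if basic: "Fun f ts \<in> basic_terms D C ar"
      and m: "(\<Sum>u\<leftarrow>normal_args safe f ts. tsize u) \<le> m" for f ts m
  proof -
    have NF: "\<forall>t\<in>set ts. NF t"
      using basic constructor_term_normal_form unfolding basic_terms_def by auto
    have "\<exists>P. ends_within R (poly ps m) P (Fun f ts)"
    proof (cases "f \<in> root_symbols")
      case True
      have "\<forall>t\<in>set (normal_args safe f ts). dep t \<le> m"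
      proof
        fix t assume "t \<in> set (normal_args safe f ts)"
        then have "tsize t \<le> (\<Sum>u\<leftarrow>normal_args safe f ts. tsize u)"
          by (intro member_le_sum_list) auto
        then show "dep t \<le> m" using m depth_le_tsize[of D t] by simp
      qed
      \<comment> \<open>Any bound on the safe depths will do, since it does not enter the step
        count.\<close>
      moreover have "\<forall>t\<in>set (safe_args safe f ts). dep t \<le> Max (dep ` set (safe_args safe f ts))"
        by simp
      ultimately have "\<exists>P. ends_within R (poly (p f) m) P (Fun f ts)"
        using p[of f] NF unfolding poly_symbol_def by blast
      then show ?thesis using ends_within_mono ps[OF True] by blast
    next
      case False
      then show ?thesis using normal_form_no_root[OF NF] ends_within_normal_form by blast
    qed
    then show ?thesis using ends_within_dh by blast
  qed
  then show ?thesis by blast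
qed

end

theorem mainTheorem3:
  fixes F D C :: "'f set"
    and ar :: "'f \<Rightarrow> nat option"
    and gt :: "'f \<Rightarrow> 'f \<Rightarrow> bool"
    and safe :: "'f \<Rightarrow> nat set"
    and R :: "('f, 'v) trs"
  assumes signature: "F = D \<union> C" "D \<inter> C = {}"
    and "constant": "\<exists>c\<in>F. ar c = Some 0"
    and finite: "finite R"
    and constructor_trs: "constructor_trs D C ar R"
    and completely_defined: "completely_defined D C ar R"
    and precedence: "precedence F gt" "\<forall>f\<in>D. \<forall>c\<in>C. gt f c"
    and safe: "safe_mapping D C ar safe"
    and oriented: "\<forall>(l, r)\<in>R. pop D C gt safe l r"
  shows "poly_bounded (normal_rc D C ar safe R) \<and> poly_bounded (innermost_rc D C ar R)"
proof -
  interpret pop_trs D C ar gt safe R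
    using assms by unfold_locales auto
  obtain p where p: "Fun f ts \<in> basic_terms D C ar \<Longrightarrow>
      (\<Sum>u\<leftarrow>normal_args safe f ts. tsize u) \<le> m \<Longrightarrow>
      dh (irstep R) (Fun f ts) \<le> enat (poly p m)" for f ts m
    using basic_term_dh by blast
  have "normal_rc D C ar safe R m \<le> enat (poly p m)" for m
    unfolding normal_rc_def using p by (auto intro!: SUP_least)
  moreover have "innermost_rc D C ar R m \<le> enat (poly p m)" for m
    unfolding innermost_rc_def
  proof (rule SUP_least)
    fix t :: "('f, 'v) trm" assume t: "t \<in> {t \<in> basic_terms D C ar. tsize t \<le> m}"
    then obtain f ts where t_eq: "t = Fun f ts" unfolding basic_terms_def by blast
    \<comment> \<open>Leaving out the safe arguments does not increase the size, so the same
      polynomial serves here.\<close>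
    have "(\<Sum>u\<leftarrow>normal_args safe f ts. tsize u) \<le> (\<Sum>u\<leftarrow>ts. tsize u)"
      unfolding normal_args_def by (rule sum_list_nths_le)
    then show "dh (irstep R) t \<le> enat (poly p m)" using t p unfolding t_eq by simp
  qed
  ultimately show ?thesis unfolding poly_bounded_def by blast
qed

end
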